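(* Let $k\geq 1$ be an integer. Every $k$-stack graph is: $\lfloor\frac{3k+4}{2}\rfloor$-choosable with defect $1$, and thus with clustering $2$; $\lfloor\frac{7k+11}{5}\rfloor$-choosable with clustering $9$; and $\lfloor\frac{4k+6}{3}\rfloor$-choosable with clustering at most $76k + 53$.
   Context: Graphs are finite and simple. A $k$-stack layout of a graph $G$ consists of a linear ordering $v_1,\dots,v_n$ of $V(G)$ and a partition $E_1,\dots,E_k$ of $E(G)$ such that for each $i$, no two edges in $E_i$ cross, where edges $v_av_b$ and $v_cv_d$ cross if $a<c<b<d$. A $k$-stack graph is a graph having a $k$-stack layout. In a coloured graph the monochromatic subgraph is the spanning subgraph of edges whose endpoints have the same colour; its connected components are monochromatic components. A colouring has defect $d$ if the monochromatic subgraph has maximum degree at most $d$, and clustering $c$ if every monochromatic component has at most $c$ vertices. A $k$-list-assignment $L$ assigns to each vertex $v$ a set $L(v)$ of at least $k$ colours; an $L$-colouring colours each $v$ with a colour from $L(v)$. $G$ is $k$-choosable with defect $d$ (resp. clustering $c$) if for every $k$-list-assignment $L$, $G$ has an $L$-colouring with defect $d$ (resp. clustering $c$). *)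

theory Defs
  imports "Graph_Theory.Graph_Theory" "HOL-Library.Disjoint_Sets"
begin

text \<open>
  Finite simple graphs are the symmetric digraphs of the locale \<^locale>\<open>pair_graph\<close>: an
  undirected edge between \<open>u\<close> and \<open>v\<close> is the pair of arcs \<open>(u, v)\<close> and \<open>(v, u)\<close>. Hence the
  out-degree is the usual degree, and strong components are the usual connected components.
\<close>

definition edges :: "'a pair_pre_digraph \<Rightarrow> 'a set set" where
  "edges G = {{u, v} | u v. (u, v) \<in> parcs G}"

text \<open>
  The relation below is not symmetric in the two edges; \<open>stack_layout\<close> excludes it for both
  orders.
\<close>

definition crosses :: "'a list \<Rightarrow> 'a set \<Rightarrow> 'a set \<Rightarrow> bool" where
  "crosses vs e e' \<longleftrightarrow>
     (\<exists>a b c d. a < c \<and> c < b \<and> b < d \<and> d < length vs \<and>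
        e = {vs ! a, vs ! b} \<and> e' = {vs ! c, vs ! d})"

text \<open>Parts of the partition may be empty, so a \<open>k\<close>-stack graph is also a \<open>(k + 1)\<close>-stack graph.\<close>

definition stack_layout ::
  "nat \<Rightarrow> 'a pair_pre_digraph \<Rightarrow> 'a list \<Rightarrow> (nat \<Rightarrow> 'a set set) \<Rightarrow> bool" where
  "stack_layout k G vs E \<longleftrightarrow>
     distinct vs \<and> set vs = pverts G \<and>
     (\<Union>i\<in>{1..k}. E i) = edges G \<and> disjoint_family_on E {1..k} \<and>
     (\<forall>i\<in>{1..k}. \<forall>e\<in>E i. \<forall>e'\<in>E i. \<not> crosses vs e e')"

definition stack_graph :: "nat \<Rightarrow> 'a pair_pre_digraph \<Rightarrow> bool" where
  "stack_graph k G \<longleftrightarrow> pair_graph G \<and> (\<exists>vs E. stack_layout k G vs E)"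

definition mono_subgraph :: "'a pair_pre_digraph \<Rightarrow> ('a \<Rightarrow> 'c) \<Rightarrow> 'a pair_pre_digraph" where
  "mono_subgraph G f =
     \<lparr> pverts = pverts G, parcs = {(u, v). (u, v) \<in> parcs G \<and> f u = f v} \<rparr>"

definition mono_components :: "'a pair_pre_digraph \<Rightarrow> ('a \<Rightarrow> 'c) \<Rightarrow> 'a set set" where
  "mono_components G f = pre_digraph.sccs_verts (with_proj (mono_subgraph G f))"

definition has_defect :: "'a pair_pre_digraph \<Rightarrow> ('a \<Rightarrow> 'c) \<Rightarrow> nat \<Rightarrow> bool" where
  "has_defect G f d \<longleftrightarrow> (\<forall>v\<in>pverts G. out_degree (with_proj (mono_subgraph G f)) v \<le> d)"

definition has_clustering :: "'a pair_pre_digraph \<Rightarrow> ('a \<Rightarrow> 'c) \<Rightarrow> nat \<Rightarrow> bool" where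
  "has_clustering G f c \<longleftrightarrow> (\<forall>C\<in>mono_components G f. card C \<le> c)"

text \<open>Lists may be infinite, where \<^const>\<open>card\<close> is \<open>0\<close>.\<close>

definition list_assignment :: "nat \<Rightarrow> 'a pair_pre_digraph \<Rightarrow> ('a \<Rightarrow> 'c set) \<Rightarrow> bool" where
  "list_assignment k G L \<longleftrightarrow> (\<forall>v\<in>pverts G. infinite (L v) \<or> k \<le> card (L v))"

definition list_colouring :: "'a pair_pre_digraph \<Rightarrow> ('a \<Rightarrow> 'c set) \<Rightarrow> ('a \<Rightarrow> 'c) \<Rightarrow> bool" where
  "list_colouring G L f \<longleftrightarrow> (\<forall>v\<in>pverts G. f v \<in> L v)"

text \<open>The type argument is the type of colours.\<close>

definition choosable_with_defect ::
  "'c itself \<Rightarrow> nat \<Rightarrow> 'a pair_pre_digraph \<Rightarrow> nat \<Rightarrow> bool" where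
  "choosable_with_defect _ k G d \<longleftrightarrow>
     (\<forall>L :: 'a \<Rightarrow> 'c set. list_assignment k G L \<longrightarrow>
        (\<exists>f. list_colouring G L f \<and> has_defect G f d))"

definition choosable_with_clustering ::
  "'c itself \<Rightarrow> nat \<Rightarrow> 'a pair_pre_digraph \<Rightarrow> nat \<Rightarrow> bool" where
  "choosable_with_clustering _ k G c \<longleftrightarrow>
     (\<forall>L :: 'a \<Rightarrow> 'c set. list_assignment k G L \<longrightarrow>
        (\<exists>f. list_colouring G L f \<and> has_clustering G f c))"

end

theory Submission
  imports Defs
begin

text \<open>
  A \<open>k\<close>-stack graph has fewer than \<open>(k + 1) * n\<close> edges on any \<open>n\<close> vertices: the pairs of
  consecutive vertices contribute at most \<open>n - 1\<close> edges and the remaining edges of each stack at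
  most \<open>n - 2\<close>. The theorem is therefore about sparse graphs. Let \<open>d\<close> be \<open>1\<close> or \<open>2\<close>. By induction
  one may colour everything outside a suitable set \<open>A\<close> first and delete from the list of each
  vertex of \<open>A\<close> the colours of its outside neighbours. For the remaining lists \<open>L\<close>, sparsity yields
  an \<open>A\<close> such that the slacks \<open>s v = (d + 1) * card (L v) - deg v\<close>, with degrees taken in \<open>A\<close>,
  add up to more than \<open>d * e(B)\<close> on every nonempty subset \<open>B\<close> of \<open>A\<close>.

  A colouring of \<open>A\<close> with the fewest monochromatic edges has defect \<open>d\<close>, which settles \<open>d = 1\<close>.
  For \<open>d = 2\<close> the condition provides an order in which every \<open>v\<close> has fewer than \<open>s v\<close> earlier
  neighbours. Breaking ties between the colourings with respect to this order makes both
  monochromatic neighbours of a vertex of monochromatic degree \<open>2\<close> later than the vertex, so that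
  no two such vertices are monochromatic neighbours and all monochromatic components have at most
  \<open>3\<close> vertices. As this uses the shortest lists in the theorem, it implies both clustering bounds
  \<open>9\<close> and \<open>76 * k + 53\<close>.
\<close>

section \<open>Neighbourhoods and degree sums\<close>

definition nbs :: "('a \<times> 'a) set \<Rightarrow> 'a set \<Rightarrow> 'a \<Rightarrow> 'a set" where
  "nbs E A v = {w \<in> A. (v, w) \<in> E}"

text \<open>For symmetric irreflexive \<open>E\<close> this is twice the number of edges induced by
  \<open>A\<close>.\<close>

definition degree_sum :: "('a \<times> 'a) set \<Rightarrow> 'a set \<Rightarrow> nat" where
  "degree_sum E A = (\<Sum>v\<in>A. card (nbs E A v))"

text \<open>The colour \<open>c\<close> need not be \<open>f v\<close>: recolouring arguments count
  the neighbours that would become monochromatic if \<open>v\<close> took the colour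
  \<open>c\<close>.\<close>

definition colour_nbs :: "('a \<times> 'a) set \<Rightarrow> 'a set \<Rightarrow> ('a \<Rightarrow> 'c) \<Rightarrow> 'a \<Rightarrow> 'c \<Rightarrow> 'a set" where
  "colour_nbs E A f v c = {w \<in> A. (v, w) \<in> E \<and> f w = c}"

abbreviation mono_nbs :: "('a \<times> 'a) set \<Rightarrow> 'a set \<Rightarrow> ('a \<Rightarrow> 'c) \<Rightarrow> 'a \<Rightarrow> 'a set" where
  "mono_nbs E A f v \<equiv> colour_nbs E A f v (f v)"

lemma finite_nbs [simp]: "finite A \<Longrightarrow> finite (nbs E A v)"
  by (simp add: nbs_def)

lemma finite_colour_nbs [simp]: "finite A \<Longrightarrow> finite (colour_nbs E A f v c)"
  by (simp add: colour_nbs_def)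

lemma card_nbs_Diff:
  assumes "finite A" "B \<subseteq> A"
  shows "card (nbs E A v) = card (nbs E (A - B) v) + card (nbs E B v)"
proof -
  have "nbs E A v = nbs E (A - B) v \<union> nbs E B v"
    using assms by (auto simp: nbs_def)
  moreover have "nbs E (A - B) v \<inter> nbs E B v = {}"
    by (auto simp: nbs_def)
  ultimately show ?thesis
    using assms by (simp add: card_Un_disjoint finite_subset)
qed

lemma sum_card_nbs_swap:
  assumes "sym E" "finite A" "finite B"
  shows "(\<Sum>v\<in>A. card (nbs E B v)) = (\<Sum>v\<in>B. card (nbs E A v))"
proof -
  have card_eq: "card (nbs E X v) = (\<Sum>w\<in>X. of_bool ((v, w) \<in> E))" if "finite X" for X v
    using that by (simp add: nbs_def of_bool_def sum.If_cases Int_def)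
  have E_iff: "(v, w) \<in> E \<longleftrightarrow> (w, v) \<in> E" for v w
    using assms(1) by (meson symD)
  have "(\<Sum>v\<in>A. card (nbs E B v)) = (\<Sum>v\<in>A. \<Sum>w\<in>B. of_bool ((v, w) \<in> E))"
    using assms(3) by (simp only: card_eq)
  also have "\<dots> = (\<Sum>w\<in>B. \<Sum>v\<in>A. of_bool ((w, v) \<in> E))"
    by (subst sum.swap) (subst E_iff, rule refl)
  also have "\<dots> = (\<Sum>v\<in>B. card (nbs E A v))"
    using assms(2) by (simp only: card_eq)
  finally show ?thesis .
qed

text \<open>The degrees in \<open>A\<close> of the vertices of \<open>B\<close> count every edge of
  \<open>A\<close> that meets \<open>B\<close>, but those inside \<open>B\<close> twice;
  \<open>degree_sum E B\<close> on the left makes up for this.\<close>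

lemma degree_sum_Diff:
  assumes "sym E" "finite A" "B \<subseteq> A"
  shows "degree_sum E A + degree_sum E B = degree_sum E (A - B) + 2 * (\<Sum>v\<in>B. card (nbs E A v))"
proof -
  have fin: "finite B" using assms finite_subset by auto
  have 1: "degree_sum E A = (\<Sum>v\<in>A - B. card (nbs E A v)) + (\<Sum>v\<in>B. card (nbs E A v))"
    unfolding degree_sum_def using assms by (simp add: sum.subset_diff)
  have 2: "(\<Sum>v\<in>A - B. card (nbs E A v)) = degree_sum E (A - B) + (\<Sum>v\<in>A - B. card (nbs E B v))"
    unfolding degree_sum_def using card_nbs_Diff[OF assms(2,3)] by (simp add: sum.distrib)
  have 3: "(\<Sum>v\<in>A - B. card (nbs E B v)) = (\<Sum>v\<in>B. card (nbs E (A - B) v))"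
    using sum_card_nbs_swap assms fin by (metis finite_Diff)
  have 4: "(\<Sum>v\<in>B. card (nbs E A v)) = (\<Sum>v\<in>B. card (nbs E (A - B) v)) + degree_sum E B"
    unfolding degree_sum_def using card_nbs_Diff[OF assms(2,3)] by (simp add: sum.distrib)
  show ?thesis using 1 2 3 4 by simp
qed

section \<open>Cores of sparse graphs\<close>

text \<open>
  \<open>A\<close> maximises the potential below and is inclusion-minimal with this property; a set \<open>B\<close>
  violating the conclusion could be removed from \<open>A\<close> without decreasing the potential.
\<close>

lemma core_exists:
  fixes d k :: nat
  assumes "sym E" "finite U"
    and sparse: "(d + 2) * degree_sum E U < 2 * (d + 1) * k * card U"
  shows "\<exists>A\<subseteq>U. A \<noteq> {} \<and> (\<forall>B\<subseteq>A. B \<noteq> {} \<longrightarrow>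
       int d * int (degree_sum E B) <
       2 * (\<Sum>v\<in>B. (int d + 1) * (int k - int (card (nbs E U v)) + int (card (nbs E A v)))
              - int (card (nbs E A v))))"
proof -
  \<comment> \<open>The slack of \<open>v\<close> equals
    \<open>(d + 1) * (k - deg v in U) + d * (deg v in A)\<close>. Hence \<open>pot A\<close> is the
    right side minus the left side of the conclusion for \<open>B = A\<close>, and for any
    \<open>B\<close> this difference is \<open>pot A - pot (A - B)\<close>.\<close>
  define pot where "pot A = int d * int (degree_sum E A)
      - 2 * (int d + 1) * (\<Sum>v\<in>A. int (card (nbs E U v)) - int k)" for A
  define best where "best = Max (pot ` Pow U)"
  have le: "pot A \<le> best" if "A \<subseteq> U" for A
    unfolding best_def using that assms(2) by (intro Max_ge) auto
  have "best \<in> pot ` Pow U"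
    unfolding best_def using assms(2) by (intro Max_in) auto
  then obtain A0 where "A0 \<subseteq> U \<and> pot A0 = best" by auto
  from ex_has_least_nat[of "\<lambda>A. A \<subseteq> U \<and> pot A = best", OF this, of card]
  obtain A where A: "A \<subseteq> U" "pot A = best"
    and min: "\<And>A'. A' \<subseteq> U \<Longrightarrow> pot A' = best \<Longrightarrow> card A \<le> card A'"
    by auto
  have finA: "finite A" using A assms(2) finite_subset by auto
  have sum_U: "(\<Sum>v\<in>U. int (card (nbs E U v)) - int k) = int (degree_sum E U) - int k * int (card U)"
    by (simp add: degree_sum_def sum_subtractf)
  \<comment> \<open>Sparsity says precisely that \<open>U\<close> has larger potential than the
    empty set, so the maximiser is nonempty.\<close>
  have "pot U = 2 * (int d + 1) * int k * int (card U) - (int d + 2) * int (degree_sum E U)"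
    unfolding pot_def sum_U by (simp add: algebra_simps)
  moreover have "(int d + 2) * int (degree_sum E U) < 2 * (int d + 1) * int k * int (card U)"
    using sparse[folded of_nat_less_iff[where ?'a = int]] by (simp add: algebra_simps)
  ultimately have "0 < pot U" by linarith
  then have "0 < best" using le[of U] by simp
  moreover have "pot {} = 0" by (simp add: pot_def degree_sum_def)
  ultimately have "A \<noteq> {}" using A by auto
  moreover have "int d * int (degree_sum E B) <
       2 * (\<Sum>v\<in>B. (int d + 1) * (int k - int (card (nbs E U v)) + int (card (nbs E A v))) - int (card (nbs E A v)))"
    if B: "B \<subseteq> A" "B \<noteq> {}" for B
  proof -
    have "card (A - B) < card A"
      using B finA by (intro psubset_card_mono) auto
    then have "pot (A - B) \<noteq> best" using min[of "A - B"] A(1) by auto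
    then have less: "pot (A - B) < pot A" using le[of "A - B"] A by fastforce
    have split: "(\<Sum>v\<in>A. int (card (nbs E U v)) - int k) =
        (\<Sum>v\<in>A - B. int (card (nbs E U v)) - int k) + (\<Sum>v\<in>B. int (card (nbs E U v)) - int k)"
      using finA B by (simp add: sum.subset_diff)
    have "degree_sum E A + degree_sum E B = degree_sum E (A - B) + 2 * (\<Sum>v\<in>B. card (nbs E A v))"
      using degree_sum_Diff assms(1) finA B(1) by blast
    then have ds: "int (degree_sum E A) = int (degree_sum E (A - B)) + 2 * (\<Sum>v\<in>B. int (card (nbs E A v))) - int (degree_sum E B)"
      by (simp flip: of_nat_sum)
    have eq: "(\<Sum>v\<in>B. (int d + 1) * (int k - int (card (nbs E U v)) + int (card (nbs E A v))) - int (card (nbs E A v)))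
      = int d * (\<Sum>v\<in>B. int (card (nbs E A v))) - (int d + 1) * (\<Sum>v\<in>B. int (card (nbs E U v)) - int k)"
      unfolding sum_distrib_left sum_subtractf[symmetric] by (rule sum.cong) (auto simp: algebra_simps)
    show ?thesis using less unfolding pot_def split eq ds by (simp add: algebra_simps)
  qed
  ultimately show ?thesis using A(1) by blast
qed

text \<open>The induction is shared by both values of \<open>d\<close>, with \<open>good\<close>
  standing for the property wanted of the colouring. Sparsity is demanded of all nonempty subsets so
  that \<open>U - A\<close> inherits it. The reduced lists leave no monochromatic edge between
  \<open>A\<close> and \<open>U - A\<close>, which is what \<open>glue\<close> asks for.\<close>

lemma colourable_if_core_colourable:
  fixes d k :: nat and L :: "'a \<Rightarrow> 'c set" and good :: "('a \<Rightarrow> 'c) \<Rightarrow> 'a set \<Rightarrow> bool"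
  assumes "sym E" "finite U"
    and sparse: "\<And>W. W \<subseteq> U \<Longrightarrow> W \<noteq> {} \<Longrightarrow> (d + 2) * degree_sum E W < 2 * (d + 1) * k * card W"
    and lists: "\<And>v. v \<in> U \<Longrightarrow> finite (L v) \<and> card (L v) = k"
    and core: "\<And>A (L :: 'a \<Rightarrow> 'c set). finite A \<Longrightarrow> (\<And>v. v \<in> A \<Longrightarrow> finite (L v)) \<Longrightarrow>
        (\<And>B. B \<subseteq> A \<Longrightarrow> B \<noteq> {} \<Longrightarrow> int d * int (degree_sum E B) <
           2 * (\<Sum>v\<in>B. (int d + 1) * int (card (L v)) - int (card (nbs E A v)))) \<Longrightarrow>
        \<exists>f. (\<forall>v\<in>A. f v \<in> L v) \<and> good f A"
    and cong: "\<And>f g A. (\<And>v. v \<in> A \<Longrightarrow> f v = g v) \<Longrightarrow> good f A \<Longrightarrow> good g A"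
    and empty: "\<And>f. good f {}"
    and glue: "\<And>f A B. A \<inter> B = {} \<Longrightarrow> good f A \<Longrightarrow> good f B \<Longrightarrow>
        (\<And>v w. v \<in> A \<Longrightarrow> w \<in> B \<Longrightarrow> (v, w) \<in> E \<Longrightarrow> f v \<noteq> f w) \<Longrightarrow> good f (A \<union> B)"
  shows "\<exists>f. (\<forall>v\<in>U. f v \<in> L v) \<and> good f U"
  using assms(2) sparse lists
proof (induction U rule: finite_psubset_induct)
  case (psubset U)
  show ?case
  proof (cases "U = {}")
    case True
    then show ?thesis using empty by auto
  next
    case False
    have spU: "(d + 2) * degree_sum E U < 2 * (d + 1) * k * card U"
      using psubset.prems(1) False by blast
    obtain A where A: "A \<subseteq> U" "A \<noteq> {}"
      and irr: "\<And>B. B \<subseteq> A \<Longrightarrow> B \<noteq> {} \<Longrightarrow>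
       int d * int (degree_sum E B) <
       2 * (\<Sum>v\<in>B. (int d + 1) * (int k - int (card (nbs E U v)) + int (card (nbs E A v))) - int (card (nbs E A v)))"
      using core_exists[OF assms(1) psubset.hyps spU] by blast
    have finA: "finite A" using A psubset.hyps finite_subset by auto
    have "U - A \<subset> U" using A by auto
    then have "\<exists>g. (\<forall>v\<in>U - A. g v \<in> L v) \<and> good g (U - A)"
      by (rule psubset.IH) (use psubset.prems in auto)
    then obtain g where g: "\<And>v. v \<in> U - A \<Longrightarrow> g v \<in> L v" "good g (U - A)" by auto
    define L' where "L' v = L v - g ` nbs E (U - A) v" for v
    \<comment> \<open>Each neighbour outside \<open>A\<close> costs at most one colour, which gives
      the list size used in \<open>core_exists\<close>.\<close>
    have card_L': "int k - int (card (nbs E U v)) + int (card (nbs E A v)) \<le> int (card (L' v))"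
      if "v \<in> A" for v
    proof -
      have "card (g ` nbs E (U - A) v) \<le> card (nbs E (U - A) v)"
        using psubset.hyps by (intro card_image_le) auto
      moreover have "card (L v) - card (g ` nbs E (U - A) v) \<le> card (L' v)"
        unfolding L'_def using psubset.hyps by (intro diff_card_le_card_Diff) auto
      moreover have "card (nbs E U v) = card (nbs E (U - A) v) + card (nbs E A v)"
        by (rule card_nbs_Diff[OF psubset.hyps A(1)])
      moreover have "card (L v) = k" using psubset.prems(2) that A by auto
      ultimately show ?thesis by linarith
    qed
    have "\<exists>f. (\<forall>v\<in>A. f v \<in> L' v) \<and> good f A"
    proof (rule core[OF finA])
      show "finite (L' v)" if "v \<in> A" for v
        using psubset.prems(2) that A by (auto simp: L'_def)
      fix B assume B: "B \<subseteq> A" "B \<noteq> {}"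
      have "(\<Sum>v\<in>B. (int d + 1) * (int k - int (card (nbs E U v)) + int (card (nbs E A v))) - int (card (nbs E A v)))
         \<le> (\<Sum>v\<in>B. (int d + 1) * int (card (L' v)) - int (card (nbs E A v)))"
        using card_L' B by (intro sum_mono diff_right_mono mult_left_mono) auto
      with irr[OF B] show "int d * int (degree_sum E B) <
           2 * (\<Sum>v\<in>B. (int d + 1) * int (card (L' v)) - int (card (nbs E A v)))"
        by linarith
    qed
    then obtain f where f: "\<And>v. v \<in> A \<Longrightarrow> f v \<in> L' v" "good f A" by auto
    define h where "h v = (if v \<in> A then f v else g v)" for v
    have "good h (A \<union> (U - A))"
    proof (rule glue)
      show "good h A" using f(2) by (rule cong[rotated]) (simp add: h_def)
      show "good h (U - A)" using g(2) by (rule cong[rotated]) (simp add: h_def)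
      show "h v \<noteq> h w" if "v \<in> A" "w \<in> U - A" "(v, w) \<in> E" for v w
        using that f(1)[of v] by (auto simp: h_def L'_def nbs_def)
    qed auto
    moreover have "A \<union> (U - A) = U" using A by auto
    moreover have "h v \<in> L v" if "v \<in> U" for v
      using that f(1)[of v] g(1)[of v] by (auto simp: h_def L'_def)
    ultimately show ?thesis by metis
  qed
qed

section \<open>Colouring a core\<close>

text \<open>Minimise the total weight of the monochromatic edges: recolouring \<open>v\<close>
  affects only the edges at \<open>v\<close>, so no colour of \<open>L v\<close> can be cheaper
  there than the present one.\<close>

lemma locally_optimal_colouring:
  fixes L :: "'a \<Rightarrow> 'c set" and wt :: "'a \<Rightarrow> 'a \<Rightarrow> nat"
  assumes "sym E" "irrefl E" "finite A"
    and "\<And>v. v \<in> A \<Longrightarrow> L v \<noteq> {}"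
    and wt_sym: "\<And>v w. wt v w = wt w v"
  shows "\<exists>f. (\<forall>v\<in>A. f v \<in> L v) \<and>
    (\<forall>v\<in>A. \<forall>c\<in>L v. (\<Sum>w\<in>mono_nbs E A f v. wt v w) \<le> (\<Sum>w\<in>colour_nbs E A f v c. wt v w))"
proof -
  define cost where
    "cost f = (\<Sum>v\<in>A. \<Sum>w\<in>A. if (v, w) \<in> E \<and> f w = f v then wt v w else 0)" for f :: "'a \<Rightarrow> 'c"
  have "\<exists>f. \<forall>v\<in>A. f v \<in> L v"
    using assms(4) by (intro exI[of _ "\<lambda>v. SOME c. c \<in> L v"]) (auto simp: some_in_eq)
  then obtain f where f: "\<forall>v\<in>A. f v \<in> L v"
    and min: "\<And>g. \<forall>v\<in>A. g v \<in> L v \<Longrightarrow> cost f \<le> cost g"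
    using ex_has_least_nat[of "\<lambda>f. \<forall>v\<in>A. f v \<in> L v" _ cost] by blast
  have "(\<Sum>w\<in>mono_nbs E A f v. wt v w) \<le> (\<Sum>w\<in>colour_nbs E A f v c. wt v w)"
    if v: "v \<in> A" "c \<in> L v" for v c
  proof -
    let ?B = "A - {v}"
    define rest where
      "rest g = (\<Sum>x\<in>?B. \<Sum>w\<in>?B. if (x, w) \<in> E \<and> g w = g x then wt x w else 0)" for g :: "'a \<Rightarrow> 'c"
    \<comment> \<open>\<open>cost\<close> counts every edge at \<open>v\<close> in both directions,
      and \<open>rest\<close> does not depend on the colour of \<open>v\<close>.\<close>
    have cost_eq: "cost g = rest g + 2 * (\<Sum>w\<in>?B. if (v, w) \<in> E \<and> g w = g v then wt v w else 0)"
      for g :: "'a \<Rightarrow> 'c"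
    proof -
      have nloop: "(v, v) \<notin> E" using assms(2) by (auto simp: irrefl_def)
      let ?t = "\<lambda>x w. if (x, w) \<in> E \<and> g w = g x then wt x w else 0"
      have t_sym: "?t x w = ?t w x" for x w
        using symD[OF assms(1), of x w] symD[OF assms(1), of w x] wt_sym[of x w] by auto
      have "cost g = (\<Sum>w\<in>A. ?t v w) + (\<Sum>x\<in>?B. \<Sum>w\<in>A. ?t x w)"
        unfolding cost_def by (rule sum.remove[OF assms(3) v(1)])
      also have "(\<Sum>w\<in>A. ?t v w) = (\<Sum>w\<in>?B. ?t v w)"
        by (subst sum.remove[OF assms(3) v(1)]) (simp add: nloop)
      also have "(\<Sum>x\<in>?B. \<Sum>w\<in>A. ?t x w) = (\<Sum>x\<in>?B. ?t x v + (\<Sum>w\<in>?B. ?t x w))"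
        by (intro sum.cong refl sum.remove[OF assms(3) v(1)])
      also have "\<dots> = (\<Sum>x\<in>?B. ?t v x) + rest g"
        unfolding sum.distrib rest_def by (subst t_sym) (rule refl)
      finally show ?thesis by simp
    qed
    have "cost f \<le> cost (f(v := c))"
      using f v by (intro min) auto
    moreover have "rest (f(v := c)) = rest f"
      unfolding rest_def by (intro sum.cong) auto
    moreover have "(\<Sum>w\<in>?B. if (v, w) \<in> E \<and> f w = c then wt v w else 0) = (\<Sum>w\<in>colour_nbs E A f v c. wt v w)" for c
    proof -
      have "colour_nbs E A f v c = {w \<in> ?B. (v, w) \<in> E \<and> f w = c}"
        using assms(2) by (auto simp: colour_nbs_def irrefl_def)
      then show ?thesis using assms(3) by (simp add: sum.If_cases Int_def)
    qed
    moreover have "(\<Sum>w\<in>?B. if (v, w) \<in> E \<and> (f(v := c)) w = (f(v := c)) v then wt v w else 0)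
      = (\<Sum>w\<in>?B. if (v, w) \<in> E \<and> f w = c then wt v w else 0)"
      by (intro sum.cong) auto
    ultimately show ?thesis by (simp add: cost_eq)
  qed
  then show ?thesis using f by blast
qed

text \<open>Repeatedly remove a vertex whose degree in the remaining set is below its threshold, and
  put it last. The bound on the ranks later keeps the weights of all edges close together.\<close>

lemma degenerate_order:
  fixes t :: "'a \<Rightarrow> nat"
  assumes "finite A"
    and "\<And>B. B \<subseteq> A \<Longrightarrow> B \<noteq> {} \<Longrightarrow> \<exists>v\<in>B. card (nbs E B v) < t v"
  shows "\<exists>r :: 'a \<Rightarrow> nat. inj_on r A \<and> (\<forall>v\<in>A. r v < card A \<and> card {w \<in> nbs E A v. r w < r v} < t v)"
  using assms
proof (induction A rule: finite_psubset_induct)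
  case (psubset A)
  show ?case
  proof (cases "A = {}")
    case False
    then obtain v where v: "v \<in> A" "card (nbs E A v) < t v"
      using psubset.prems[of A] by auto
    then obtain r where r: "inj_on r (A - {v})"
      "\<And>x. x \<in> A - {v} \<Longrightarrow> r x < card (A - {v}) \<and> card {w \<in> nbs E (A - {v}) x. r w < r x} < t x"
      using psubset.IH[of "A - {v}"] psubset.prems by (auto simp: subset_Diff_insert)
    \<comment> \<open>As \<open>v\<close> gets the largest rank, the earlier neighbours of the other
      vertices stay the same.\<close>
    define r' where "r' = r(v := card (A - {v}))"
    have c: "card A = Suc (card (A - {v}))"
      using v psubset.hyps by (metis card_Suc_Diff1)
    have "inj_on r' A"
      using r by (fastforce simp: r'_def inj_on_def)
    moreover have "card {w \<in> nbs E A x. r' w < r' x} < t x" if "x \<in> A" for x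
    proof (cases "x = v")
      case True
      have "card {w \<in> nbs E A v. r' w < r' v} \<le> card (nbs E A v)"
        using psubset.hyps by (intro card_mono) auto
      then show ?thesis using v True by simp
    next
      case False
      have "{w \<in> nbs E A x. r' w < r' x} = {w \<in> nbs E (A - {v}) x. r w < r x}"
        using r(2)[of x] that False by (auto simp: r'_def nbs_def)
      then show ?thesis using r(2)[of x] that False by simp
    qed
    moreover have "r' x < card A" if "x \<in> A" for x
      using r(2)[of x] that c by (auto simp: r'_def)
    ultimately show ?thesis by blast
  qed auto
qed

lemma sum_card_colour_nbs_le:
  assumes "finite A" "finite C"
  shows "(\<Sum>c\<in>C. card (colour_nbs E A f v c)) \<le> card (nbs E A v)"
proof -
  have "(\<Sum>c\<in>C. card (colour_nbs E A f v c)) = card (\<Union>c\<in>C. colour_nbs E A f v c)"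
    using assms by (intro card_UN_disjoint[symmetric]) (auto simp: colour_nbs_def)
  also have "\<dots> \<le> card (nbs E A v)"
    using assms by (intro card_mono) (auto simp: colour_nbs_def nbs_def)
  finally show ?thesis .
qed

text \<open>With unit weights, \<open>v\<close> has a rarest colour of its list. If that colour
  occurred twice around \<open>v\<close>, so would every colour of \<open>L v\<close>, and
  \<open>v\<close> would have at least \<open>2 * card (L v)\<close> neighbours.\<close>

lemma core_colouring_defect_1:
  fixes L :: "'a \<Rightarrow> 'c set"
  assumes "sym E" "irrefl E" "finite A" "\<And>v. v \<in> A \<Longrightarrow> finite (L v)"
    and small: "\<And>v. v \<in> A \<Longrightarrow> card (nbs E A v) < 2 * card (L v)"
  shows "\<exists>f. (\<forall>v\<in>A. f v \<in> L v) \<and> (\<forall>v\<in>A. card (mono_nbs E A f v) \<le> 1)"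
proof -
  have "L v \<noteq> {}" if "v \<in> A" for v using small[OF that] by auto
  then obtain f where f: "\<forall>v\<in>A. f v \<in> L v"
    "\<forall>v\<in>A. \<forall>c\<in>L v. card (mono_nbs E A f v) \<le> card (colour_nbs E A f v c)"
    using locally_optimal_colouring[OF assms(1-3), of L "\<lambda>_ _. 1"] by auto
  have "card (mono_nbs E A f v) \<le> 1" if v: "v \<in> A" for v
  proof -
    have "card (L v) * card (mono_nbs E A f v) \<le> (\<Sum>c\<in>L v. card (colour_nbs E A f v c))"
      using sum_mono[of "L v" "\<lambda>_. card (mono_nbs E A f v)"] f(2) v by simp
    also have "\<dots> \<le> card (nbs E A v)"
      by (rule sum_card_colour_nbs_le[OF assms(3) assms(4)[OF v]])
    finally have "card (L v) * card (mono_nbs E A f v) < card (L v) * 2"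
      using small[OF v] by linarith
    then show ?thesis by simp
  qed
  then show ?thesis using f by blast
qed

text \<open>
  An edge costs less the later its earlier end comes in the order \<open>r\<close>, but the number of
  monochromatic edges dominates the cost. If \<open>v\<close> has two monochromatic neighbours, then at least
  \<open>3 * card (L v) - deg v\<close> colours occur exactly twice around \<open>v\<close>, and one of them does not occur
  on an earlier neighbour. Optimality then makes both monochromatic neighbours of \<open>v\<close> later
  than \<open>v\<close>, which cannot hold at both ends of an edge.
\<close>

lemma core_colouring_clustering_3:
  fixes L :: "'a \<Rightarrow> 'c set"
  assumes "sym E" "irrefl E" "finite A" "\<And>v. v \<in> A \<Longrightarrow> finite (L v)"
    and irr: "\<And>B. B \<subseteq> A \<Longrightarrow> B \<noteq> {} \<Longrightarrow>
        int (degree_sum E B) < (\<Sum>v\<in>B. 3 * int (card (L v)) - int (card (nbs E A v)))"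
  shows "\<exists>f. (\<forall>v\<in>A. f v \<in> L v) \<and> (\<forall>v\<in>A. card (mono_nbs E A f v) \<le> 2 \<and>
      (card (mono_nbs E A f v) = 2 \<longrightarrow> (\<forall>w\<in>mono_nbs E A f v. card (mono_nbs E A f w) \<le> 1)))"
proof -
  have nbs_lt: "card (nbs E A v) < 3 * card (L v)" if "v \<in> A" for v
    using irr[of "{v}"] that by auto
  have "\<exists>v\<in>B. card (nbs E B v) < 3 * card (L v) - card (nbs E A v)" if B: "B \<subseteq> A" "B \<noteq> {}" for B
  proof (rule ccontr)
    \<comment> \<open>If every vertex of \<open>B\<close> failed, summing over \<open>B\<close>
      would contradict \<open>irr\<close>.\<close>
    assume neg: "\<not> ?thesis"
    have "(\<Sum>v\<in>B. 3 * int (card (L v)) - int (card (nbs E A v))) \<le> (\<Sum>v\<in>B. int (card (nbs E B v)))"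
    proof (rule sum_mono)
      fix v assume "v \<in> B"
      then have "3 * card (L v) - card (nbs E A v) \<le> card (nbs E B v)"
        using neg by force
      then show "3 * int (card (L v)) - int (card (nbs E A v)) \<le> int (card (nbs E B v))" by linarith
    qed
    then show False using irr[OF B] by (simp add: degree_sum_def)
  qed
  then obtain r :: "'a \<Rightarrow> nat" where r: "inj_on r A" "\<And>v. v \<in> A \<Longrightarrow> r v < card A"
    "\<And>v. v \<in> A \<Longrightarrow> card {w \<in> nbs E A v. r w < r v} < 3 * card (L v) - card (nbs E A v)"
    using degenerate_order[OF assms(3), of E "\<lambda>v. 3 * card (L v) - card (nbs E A v)"] by blast
  define n where "n = card A"
  \<comment> \<open>All weights at a vertex of \<open>A\<close> lie between \<open>K - n\<close> and
    \<open>K\<close>. As \<open>K > (n + 1) * n\<close> for \<open>n > 0\<close>, any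
    \<open>j + 1\<close> edges outweigh \<open>j\<close> edges when \<open>j \<le> n\<close>, so the
    order matters only between equal numbers of edges.\<close>
  define K where "K = n * n + 2 * n"
  define wt where "wt v w = K - min (r v) (r w)" for v w
  have wt_sym: "wt v w = wt w v" for v w by (simp add: wt_def min.commute)
  have "L v \<noteq> {}" if "v \<in> A" for v using nbs_lt[OF that] by auto
  then obtain f where f: "\<forall>v\<in>A. f v \<in> L v"
    "\<forall>v\<in>A. \<forall>c\<in>L v. (\<Sum>w\<in>mono_nbs E A f v. wt v w) \<le> (\<Sum>w\<in>colour_nbs E A f v c. wt v w)"
    using locally_optimal_colouring[OF assms(1-3), of L wt] wt_sym by blast
  let ?N = "colour_nbs E A f"
  have card_le_n: "card (?N v c) \<le> n" for v c
    unfolding n_def using assms(3) by (intro card_mono) (auto simp: colour_nbs_def)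
  have fewest: "card (mono_nbs E A f v) \<le> card (?N v c)" if v: "v \<in> A" "c \<in> L v" for v c
  proof (rule ccontr)
    let ?i = "card (mono_nbs E A f v)" and ?j = "card (?N v c)"
    assume "\<not> ?i \<le> ?j"
    then have less: "?j + 1 \<le> ?i" by simp
    have rn: "r w < n" if "w \<in> A" for w using r(2) that by (simp add: n_def)
    have "?i * (K - n) \<le> (\<Sum>w\<in>mono_nbs E A f v. wt v w)"
      using sum_mono[of "mono_nbs E A f v" "\<lambda>_. K - n" "wt v"] rn[OF v(1)]
      by (simp add: wt_def diff_le_mono2)
    also have "\<dots> \<le> (\<Sum>w\<in>?N v c. wt v w)" using f(2) v by blast
    also have "\<dots> \<le> ?j * K"
      using sum_mono[of "?N v c" "wt v" "\<lambda>_. K"] by (simp add: wt_def)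
    finally have "?i * (K - n) \<le> ?j * K" .
    moreover have "(?j + 1) * (K - n) \<le> ?i * (K - n)" using less by (rule mult_le_mono1)
    moreover have "(?j + 1) * (K - n) = ?j * (n * n + n) + (n * n + n)"
      by (simp add: K_def algebra_simps)
    moreover have "?j * K = ?j * (n * n + n) + ?j * n"
      by (simp add: K_def algebra_simps)
    moreover have "?j * n \<le> n * n" using card_le_n by simp
    moreover have "n > 0" using v(1) assms(3) by (auto simp: n_def card_gt_0_iff)
    ultimately show False by linarith
  qed
  have colours_le: "(\<Sum>c\<in>L v. card (?N v c)) \<le> card (nbs E A v)" if "v \<in> A" for v
    by (rule sum_card_colour_nbs_le[OF assms(3) assms(4)[OF that]])
  have le_2: "card (mono_nbs E A f v) \<le> 2" if v: "v \<in> A" for v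
  proof -
    have "card (L v) * card (mono_nbs E A f v) \<le> (\<Sum>c\<in>L v. card (?N v c))"
      using sum_mono[of "L v" "\<lambda>_. card (mono_nbs E A f v)"] fewest[OF v] by simp
    then have "card (L v) * card (mono_nbs E A f v) < card (L v) * 3"
      using colours_le[OF v] nbs_lt[OF v] by linarith
    then show ?thesis by simp
  qed
  have later: "r v < r w" if v: "v \<in> A" "card (mono_nbs E A f v) = 2" and w: "w \<in> mono_nbs E A f v" for v w
  proof -
    let ?Q = "{c \<in> L v. card (?N v c) = 2}"
    let ?early = "{w \<in> nbs E A v. r w < r v}"
    have finL: "finite (L v)" using assms(4) v by auto
    \<comment> \<open>Every colour of \<open>L v\<close> occurs at least twice around
      \<open>v\<close>, hence at least three times if it is not in \<open>?Q\<close>.\<close>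
    have "3 * card (L v) = (\<Sum>c\<in>L v. 3)" by simp
    also have "\<dots> \<le> (\<Sum>c\<in>L v. card (?N v c) + (if card (?N v c) = 2 then 1 else 0))"
      using fewest[OF v(1)] v(2) by (intro sum_mono) force
    also have "\<dots> = (\<Sum>c\<in>L v. card (?N v c)) + card ?Q"
      using finL by (simp add: sum.distrib sum.If_cases Int_def)
    finally have "card ?early < card ?Q"
      using colours_le[OF v(1)] r(3)[OF v(1)] by linarith
    moreover have "card (f ` ?early) \<le> card ?early"
      using assms(3) by (intro card_image_le) auto
    ultimately have "\<not> ?Q \<subseteq> f ` ?early"
      using card_mono[of "f ` ?early" ?Q] assms(3) by auto
    then obtain c where c: "c \<in> L v" "card (?N v c) = 2" "c \<notin> f ` ?early" by auto
    \<comment> \<open>In colour \<open>c\<close> both edges would have weight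
      \<open>K - r v\<close>, the least possible at \<open>v\<close>. By optimality the two present
      monochromatic edges attain it as well, so neither leads to an earlier vertex.\<close>
    have "wt v x = K - r v" if "x \<in> ?N v c" for x
    proof -
      have "\<not> r x < r v"
        using that c(3) by (auto simp: colour_nbs_def nbs_def)
      then show ?thesis by (simp add: wt_def min_def)
    qed
    then have "(\<Sum>x\<in>?N v c. wt v x) = 2 * (K - r v)" using c(2) by simp
    moreover have "(\<Sum>x\<in>mono_nbs E A f v. wt v x) \<le> (\<Sum>x\<in>?N v c. wt v x)"
      using f(2) v(1) c(1) by blast
    ultimately have le: "(\<Sum>x\<in>mono_nbs E A f v. wt v x) \<le> 2 * (K - r v)" by linarith
    have ge: "K - r v \<le> wt v x" for x by (simp add: wt_def diff_le_mono2)
    have fin: "finite (mono_nbs E A f v)" using assms(3) by simp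
    have "card (mono_nbs E A f v - {w}) = 1" using v(2) w fin by simp
    then have "(K - r v) \<le> (\<Sum>x\<in>mono_nbs E A f v - {w}. wt v x)"
      using sum_mono[of "mono_nbs E A f v - {w}" "\<lambda>_. K - r v" "wt v"] ge by simp
    moreover have "(\<Sum>x\<in>mono_nbs E A f v. wt v x) = wt v w + (\<Sum>x\<in>mono_nbs E A f v - {w}. wt v x)"
      using w fin by (simp add: sum.remove)
    ultimately have "wt v w \<le> K - r v" using le by linarith
    moreover have "w \<in> A" "w \<noteq> v"
      using w assms(2) by (auto simp: colour_nbs_def irrefl_def)
    \<comment> \<open>This keeps the truncated subtraction in \<open>wt\<close> from hiding a
      difference of ranks.\<close>
    moreover have "r v < K" using r(2)[OF v(1)] unfolding K_def n_def by linarith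
    ultimately have "r v \<le> r w" by (auto simp: wt_def min_def split: if_splits)
    moreover have "r v \<noteq> r w"
      using r(1) v(1) \<open>w \<in> A\<close> \<open>w \<noteq> v\<close> by (auto dest: inj_onD)
    ultimately show ?thesis by simp
  qed
  have "card (mono_nbs E A f w) \<le> 1"
    if v: "v \<in> A" "card (mono_nbs E A f v) = 2" and w: "w \<in> mono_nbs E A f v" for v w
  proof (rule ccontr)
    assume "\<not> ?thesis"
    moreover have "w \<in> A" using w by (simp add: colour_nbs_def)
    ultimately have "card (mono_nbs E A f w) = 2" using le_2[of w] by simp
    moreover have "v \<in> mono_nbs E A f w"
      using w v assms(1) by (auto simp: colour_nbs_def dest: symD)
    ultimately show False using later[of v w] later[of w v] v w \<open>w \<in> A\<close> by force
  qed
  then show ?thesis using f(1) le_2 by blast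
qed

section \<open>Colouring sparse graphs\<close>

lemma mono_nbs_cong:
  assumes "\<And>v. v \<in> A \<Longrightarrow> f v = g v" "v \<in> A"
  shows "mono_nbs E A f v = mono_nbs E A g v"
  using assms by (auto simp: colour_nbs_def)

lemma mono_nbs_Un:
  assumes "\<And>w. w \<in> B \<Longrightarrow> (v, w) \<in> E \<Longrightarrow> f v \<noteq> f w"
  shows "mono_nbs E (A \<union> B) f v = mono_nbs E A f v"
  using assms by (fastforce simp: colour_nbs_def)

text \<open>The factors \<open>3\<close> and \<open>4\<close> are \<open>d + 2\<close> and
  \<open>2 * (d + 1)\<close> for \<open>d = 1\<close>.\<close>

lemma sparse_colouring_defect_1:
  fixes L :: "'a \<Rightarrow> 'c set"
  assumes "sym E" "irrefl E" "finite U"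
    and "\<And>W. W \<subseteq> U \<Longrightarrow> W \<noteq> {} \<Longrightarrow> 3 * degree_sum E W < 4 * k * card W"
    and "\<And>v. v \<in> U \<Longrightarrow> finite (L v) \<and> card (L v) = k"
  shows "\<exists>f. (\<forall>v\<in>U. f v \<in> L v) \<and> (\<forall>v\<in>U. card (mono_nbs E U f v) \<le> 1)"
proof (rule colourable_if_core_colourable[where d = 1 and E = E and k = k])
  fix A and L' :: "'a \<Rightarrow> 'c set"
  assume A: "finite A" "\<And>v. v \<in> A \<Longrightarrow> finite (L' v)"
    "\<And>B. B \<subseteq> A \<Longrightarrow> B \<noteq> {} \<Longrightarrow> int 1 * int (degree_sum E B) <
       2 * (\<Sum>v\<in>B. (int 1 + 1) * int (card (L' v)) - int (card (nbs E A v)))"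
  have "card (nbs E A v) < 2 * card (L' v)" if "v \<in> A" for v
    using A(3)[of "{v}"] that by simp
  then show "\<exists>f. (\<forall>v\<in>A. f v \<in> L' v) \<and> (\<forall>v\<in>A. card (mono_nbs E A f v) \<le> 1)"
    using core_colouring_defect_1 assms(1,2) A(1,2) by blast
next
  fix W assume "W \<subseteq> U" "W \<noteq> {}"
  then show "(1 + 2) * degree_sum E W < 2 * (1 + 1) * k * card W"
    using assms(4)[of W] by simp
next
  fix f g :: "'a \<Rightarrow> 'c" and A
  assume "\<And>v. v \<in> A \<Longrightarrow> f v = g v" "\<forall>v\<in>A. card (mono_nbs E A f v) \<le> 1"
  then show "\<forall>v\<in>A. card (mono_nbs E A g v) \<le> 1"
    using mono_nbs_cong[of A f g] by simp
next
  fix f :: "'a \<Rightarrow> 'c" and A B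
  assume AB: "A \<inter> B = {}" "\<forall>v\<in>A. card (mono_nbs E A f v) \<le> 1" "\<forall>v\<in>B. card (mono_nbs E B f v) \<le> 1"
    "\<And>v w. v \<in> A \<Longrightarrow> w \<in> B \<Longrightarrow> (v, w) \<in> E \<Longrightarrow> f v \<noteq> f w"
  have "mono_nbs E (A \<union> B) f v = mono_nbs E A f v" if "v \<in> A" for v
    using that AB(4) by (intro mono_nbs_Un) auto
  moreover have "mono_nbs E (A \<union> B) f v = mono_nbs E B f v" if "v \<in> B" for v
    unfolding Un_commute[of A B] using that AB(4) assms(1)
    by (intro mono_nbs_Un) (metis symD)
  ultimately show "\<forall>v\<in>A \<union> B. card (mono_nbs E (A \<union> B) f v) \<le> 1"
    using AB by auto
qed (use assms in auto)

text \<open>The factors \<open>2\<close> and \<open>3\<close> are half of \<open>d + 2\<close> and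
  \<open>2 * (d + 1)\<close> for \<open>d = 2\<close>. The conclusion makes the monochromatic
  components paths on at most three vertices; stated through neighbourhoods alone, it is easily
  glued by \<open>mono_nbs_Un\<close>.\<close>

lemma sparse_colouring_clustering_3:
  fixes L :: "'a \<Rightarrow> 'c set"
  assumes "sym E" "irrefl E" "finite U"
    and "\<And>W. W \<subseteq> U \<Longrightarrow> W \<noteq> {} \<Longrightarrow> 2 * degree_sum E W < 3 * k * card W"
    and "\<And>v. v \<in> U \<Longrightarrow> finite (L v) \<and> card (L v) = k"
  shows "\<exists>f. (\<forall>v\<in>U. f v \<in> L v) \<and> (\<forall>v\<in>U. card (mono_nbs E U f v) \<le> 2 \<and>
      (card (mono_nbs E U f v) = 2 \<longrightarrow> (\<forall>w\<in>mono_nbs E U f v. card (mono_nbs E U f w) \<le> 1)))"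
proof (rule colourable_if_core_colourable[where d = 2 and E = E and k = k])
  fix A and L' :: "'a \<Rightarrow> 'c set"
  assume A: "finite A" "\<And>v. v \<in> A \<Longrightarrow> finite (L' v)"
    "\<And>B. B \<subseteq> A \<Longrightarrow> B \<noteq> {} \<Longrightarrow> int 2 * int (degree_sum E B) <
       2 * (\<Sum>v\<in>B. (int 2 + 1) * int (card (L' v)) - int (card (nbs E A v)))"
  show "\<exists>f. (\<forall>v\<in>A. f v \<in> L' v) \<and> (\<forall>v\<in>A. card (mono_nbs E A f v) \<le> 2 \<and>
      (card (mono_nbs E A f v) = 2 \<longrightarrow> (\<forall>w\<in>mono_nbs E A f v. card (mono_nbs E A f w) \<le> 1)))"
    using A by (intro core_colouring_clustering_3 assms(1,2)) auto
next
  fix W assume "W \<subseteq> U" "W \<noteq> {}"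
  then show "(2 + 2) * degree_sum E W < 2 * (2 + 1) * k * card W"
    using assms(4)[of W] by simp
next
  fix f g :: "'a \<Rightarrow> 'c" and A
  assume fg: "\<And>v. v \<in> A \<Longrightarrow> f v = g v"
  have "w \<in> A" if "w \<in> mono_nbs E A f v" for v w
    using that by (simp add: colour_nbs_def)
  moreover assume "\<forall>v\<in>A. card (mono_nbs E A f v) \<le> 2 \<and>
      (card (mono_nbs E A f v) = 2 \<longrightarrow> (\<forall>w\<in>mono_nbs E A f v. card (mono_nbs E A f w) \<le> 1))"
  ultimately show "\<forall>v\<in>A. card (mono_nbs E A g v) \<le> 2 \<and>
      (card (mono_nbs E A g v) = 2 \<longrightarrow> (\<forall>w\<in>mono_nbs E A g v. card (mono_nbs E A g w) \<le> 1))"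
    using mono_nbs_cong[of A f g, OF fg] by metis
next
  fix f :: "'a \<Rightarrow> 'c" and A B
  let ?good = "\<lambda>A. \<forall>v\<in>A. card (mono_nbs E A f v) \<le> 2 \<and>
      (card (mono_nbs E A f v) = 2 \<longrightarrow> (\<forall>w\<in>mono_nbs E A f v. card (mono_nbs E A f w) \<le> 1))"
  assume AB: "A \<inter> B = {}" "?good A" "?good B"
    "\<And>v w. v \<in> A \<Longrightarrow> w \<in> B \<Longrightarrow> (v, w) \<in> E \<Longrightarrow> f v \<noteq> f w"
  have "mono_nbs E (A \<union> B) f v = mono_nbs E A f v" if "v \<in> A" for v
    using that AB(4) by (intro mono_nbs_Un) auto
  moreover have "mono_nbs E (A \<union> B) f v = mono_nbs E B f v" if "v \<in> B" for v
    unfolding Un_commute[of A B] using that AB(4) assms(1)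
    by (intro mono_nbs_Un) (metis symD)
  moreover have "w \<in> X" if "w \<in> mono_nbs E X f v" for v w X
    using that by (simp add: colour_nbs_def)
  ultimately show "?good (A \<union> B)"
    using AB(2,3) by (metis (no_types, lifting) Un_iff)
qed (use assms in auto)

section \<open>Sparsity of graphs with a stack layout\<close>

text \<open>Pairs that are consecutive in \<open>U\<close> are left out, as they can be counted once
  for all stacks together.\<close>

definition chords :: "(nat \<times> nat) set \<Rightarrow> nat set \<Rightarrow> (nat \<times> nat) set" where
  "chords P U = {(a, b) \<in> P. a \<in> U \<and> b \<in> U \<and> (\<exists>c\<in>U. a < c \<and> c < b)}"

text \<open>No chord ends at a point below a shortest chord, so that point can be removed.\<close>

lemma card_noncrossing_chords:
  assumes "finite U"
    and noncrossing: "\<And>a b c d. (a, b) \<in> P \<Longrightarrow> (c, d) \<in> P \<Longrightarrow> \<not> (a < c \<and> c < b \<and> b < d)"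
  shows "card (chords P U) \<le> card U - 2"
  using assms(1)
proof (induction U rule: finite_psubset_induct)
  case (psubset U)
  show ?case
  proof (cases "chords P U = {}")
    case False
    then obtain e where "e \<in> chords P U" by auto
    from ex_has_least_nat[of "\<lambda>e. e \<in> chords P U", OF this, of "\<lambda>e. snd e - fst e"]
    obtain a b where ab: "(a, b) \<in> chords P U"
      and min: "\<And>x y. (x, y) \<in> chords P U \<Longrightarrow> b - a \<le> y - x" by auto
    then obtain c where c: "c \<in> U" "a < c" "c < b" by (auto simp: chords_def)
    \<comment> \<open>A chord with an end at \<open>c\<close> would either cross
      \<open>(a, b)\<close> or lie within it and be shorter.\<close>
    have not_c: "x \<noteq> c \<and> y \<noteq> c" if xy: "(x, y) \<in> chords P U" for x y
    proof -
      have P: "(x, y) \<in> P" "(a, b) \<in> P" "x < y" using xy ab by (auto simp: chords_def)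
      have "b - a \<le> y - x" using min xy by blast
      then show ?thesis
        using noncrossing[OF P(1,2)] noncrossing[OF P(2,1)] P(3) c by linarith
    qed
    \<comment> \<open>A chord is lost with \<open>c\<close> only if \<open>c\<close> is the sole
      point of \<open>U\<close> below it. Its ends are then the two neighbours of \<open>c\<close>
      in \<open>U\<close>, so at most one chord is lost.\<close>
    let ?X = "chords P U - chords P (U - {c})"
    have fin: "finite (chords P V)" if "finite V" for V
      using that by (intro finite_subset[of "chords P V" "V \<times> V"]) (auto simp: chords_def)
    have only_c: "x < c \<and> c < y \<and> x \<in> U \<and> y \<in> U \<and> (\<forall>z\<in>U. x < z \<and> z < y \<longrightarrow> z = c)"
      if "(x, y) \<in> ?X" for x y
      using that not_c[of x y] by (auto simp: chords_def)
    have "p = q" if "p \<in> ?X" "q \<in> ?X" for p q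
    proof -
      obtain x y x' y' where [simp]: "p = (x, y)" "q = (x', y')" by (cases p, cases q)
      have "\<not> x < x'" "\<not> x' < x" "\<not> y < y'" "\<not> y' < y"
        using only_c[of x y] only_c[of x' y'] that by (auto dest: less_trans)
      then show ?thesis by simp
    qed
    then have "card ?X \<le> 1"
      using fin[OF psubset.hyps] by (simp add: card_le_Suc0_iff_eq)
    moreover have "card (chords P (U - {c})) \<le> card (U - {c}) - 2"
      using c by (intro psubset.IH) auto
    moreover have "card (chords P U) \<le> card (chords P (U - {c})) + card ?X"
      by (rule order_trans[OF card_mono card_Un_le]) (use fin psubset.hyps in auto)
    \<comment> \<open>With at least three points in \<open>U\<close>, the truncated
      \<open>card U - 2\<close> really drops by one when \<open>c\<close> is removed.\<close>
    moreover have "card {a, c, b} \<le> card U"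
      using ab c psubset.hyps by (intro card_mono) (auto simp: chords_def)
    ultimately show ?thesis using c psubset.hyps by simp
  qed simp
qed

text \<open>Vertices are replaced by their positions in \<open>vs\<close>, and an edge is short if
  no position of \<open>W\<close> lies strictly between its ends. The factor \<open>2\<close> arises
  because \<open>degree_sum\<close> counts each edge twice.\<close>

lemma stack_layout_sparse:
  assumes "pair_graph G" "stack_layout k G vs S" "W \<subseteq> pverts G" "W \<noteq> {}"
  shows "degree_sum (parcs G) W < 2 * (k + 1) * card W"
proof -
  interpret pair_graph G by fact
  let ?E = "parcs G" and ?n = "length vs"
  define I where "I = {i. i < ?n \<and> vs ! i \<in> W}"
  define F where "F = {(i, j). i \<in> I \<and> j \<in> I \<and> i < j \<and> (vs ! i, vs ! j) \<in> ?E}"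
  define P where "P l = {(i, j). i < j \<and> j < ?n \<and> {vs ! i, vs ! j} \<in> S l}" for l
  define short where "short = {(i, j). i \<in> I \<and> j \<in> I \<and> i < j \<and> (\<forall>c\<in>I. \<not> (i < c \<and> c < j))}"
  have vs: "distinct vs" "set vs = pverts G" and S: "(\<Union>l\<in>{1..k}. S l) = edges G"
    and nc: "\<And>l e e'. l \<in> {1..k} \<Longrightarrow> e \<in> S l \<Longrightarrow> e' \<in> S l \<Longrightarrow> \<not> crosses vs e e'"
    using assms(2) unfolding stack_layout_def by blast+
  have symE: "(v, w) \<in> ?E \<Longrightarrow> (w, v) \<in> ?E" for v w
    using pair_sym_arcs by (auto simp: symmetric_def dest: symD)
  have finI: "finite I" by (simp add: I_def)
  have finW: "finite W" by (rule finite_subset[OF assms(3) pair_finite_verts])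
  have "card I = card ((!) vs ` I)"
    using vs(1) by (intro card_image[symmetric] inj_on_nth) (auto simp: I_def)
  also have "\<dots> \<le> card W"
    using finW by (intro card_mono) (auto simp: I_def)
  finally have card_I: "card I \<le> card W" .
  have finF: "finite F"
    using finI by (intro finite_subset[of F "I \<times> I"]) (auto simp: F_def)
  have "degree_sum ?E W = card (SIGMA v:W. nbs ?E W v)"
    using finW by (simp add: degree_sum_def)
  also have "\<dots> \<le> card ((\<lambda>(i, j). (vs ! i, vs ! j)) ` F \<union> (\<lambda>(i, j). (vs ! j, vs ! i)) ` F)"
  proof (intro card_mono subsetI)
    fix p assume "p \<in> (SIGMA v:W. nbs ?E W v)"
    then obtain v w where p: "p = (v, w)" "v \<in> W" "w \<in> W" "(v, w) \<in> ?E"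
      by (auto simp: nbs_def)
    then have "v \<in> set vs" "w \<in> set vs" using vs(2) assms(3) by auto
    then obtain i j where ij: "i < ?n" "vs ! i = v" "j < ?n" "vs ! j = w"
      by (auto simp: in_set_conv_nth)
    have "v \<noteq> w" using pair_no_loops[OF p(4)] by simp
    then have "i < j \<or> j < i" using ij by (metis linorder_neqE_nat)
    then have "(i, j) \<in> F \<or> (j, i) \<in> F"
      using p ij symE by (auto simp: F_def I_def)
    then show "p \<in> (\<lambda>(i, j). (vs ! i, vs ! j)) ` F \<union> (\<lambda>(i, j). (vs ! j, vs ! i)) ` F"
    proof
      assume "(i, j) \<in> F"
      then have "p \<in> (\<lambda>(i, j). (vs ! i, vs ! j)) ` F"
        by (rule rev_image_eqI) (use p(1) ij in simp)
      then show ?thesis ..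
    next
      assume "(j, i) \<in> F"
      then have "p \<in> (\<lambda>(i, j). (vs ! j, vs ! i)) ` F"
        by (rule rev_image_eqI) (use p(1) ij in simp)
      then show ?thesis ..
    qed
  qed (use finF in auto)
  also have "\<dots> \<le> card F + card F"
    using finF by (intro order_trans[OF card_Un_le] add_mono card_image_le)
  finally have deg: "degree_sum ?E W \<le> 2 * card F" by simp
  have "F \<subseteq> short \<union> (\<Union>l\<in>{1..k}. chords (P l) I)"
  proof
    fix p assume "p \<in> F"
    then obtain i j where p: "p = (i, j)" "i \<in> I" "j \<in> I" "i < j" "(vs ! i, vs ! j) \<in> ?E"
      by (auto simp: F_def)
    then have "{vs ! i, vs ! j} \<in> (\<Union>l\<in>{1..k}. S l)" unfolding S by (auto simp: edges_def)
    then obtain l where "l \<in> {1..k}" "{vs ! i, vs ! j} \<in> S l" by auto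
    then show "p \<in> short \<union> (\<Union>l\<in>{1..k}. chords (P l) I)"
      using p by (auto simp: short_def chords_def P_def I_def)
  qed
  moreover have fin_short: "finite short"
    using finI by (intro finite_subset[of short "I \<times> I"]) (auto simp: short_def)
  moreover have fin_chords: "finite (chords Q I)" for Q
    using finI by (intro finite_subset[of "chords Q I" "I \<times> I"]) (auto simp: chords_def)
  ultimately have "card F \<le> card (short \<union> (\<Union>l\<in>{1..k}. chords (P l) I))"
    by (intro card_mono) auto
  also have "\<dots> \<le> card short + (\<Sum>l\<in>{1..k}. card (chords (P l) I))"
    by (intro order_trans[OF card_Un_le] add_mono order_refl card_UN_le) auto
  also have "(\<Sum>l\<in>{1..k}. card (chords (P l) I)) \<le> (\<Sum>l\<in>{1..k}. card W)"
  proof (intro sum_mono)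
    fix l assume l: "l \<in> {1..k}"
    have "card (chords (P l) I) \<le> card I - 2"
    proof (rule card_noncrossing_chords[OF finI])
      fix a b c d assume ab: "(a, b) \<in> P l" "(c, d) \<in> P l"
      show "\<not> (a < c \<and> c < b \<and> b < d)"
        using nc[OF l, of "{vs ! a, vs ! b}" "{vs ! c, vs ! d}"] ab
        by (auto simp: P_def crosses_def)
    qed
    then show "card (chords (P l) I) \<le> card W" using card_I by simp
  qed
  also have "card short < card W"
  proof (cases "I = {}")
    case True
    then have "short = {}" by (auto simp: short_def)
    then show ?thesis using finW assms(4) by (simp add: card_gt_0_iff)
  next
    case False
    \<comment> \<open>A short pair is determined by its left end, which is never the last position;
      this makes the total bound strict.\<close>
    have "inj_on fst short"
      by (rule inj_onI) (auto simp: short_def, metis linorder_neqE_nat)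
    then have "card short = card (fst ` short)" by (simp add: card_image)
    also have "\<dots> \<le> card (I - {Max I})"
    proof (intro card_mono subsetI)
      fix a assume "a \<in> fst ` short"
      then obtain b where "a \<in> I" "b \<in> I" "a < b" by (auto simp: short_def)
      then show "a \<in> I - {Max I}" using Max_ge[OF finI, of b] by auto
    qed (use finI in auto)
    also have "\<dots> < card I" using finI False by (intro card_Diff1_less Max_in)
    finally show ?thesis using card_I by simp
  qed
  finally have "card F < card W + k * card W" by simp
  then show ?thesis using deg by (simp add: algebra_simps)
qed

section \<open>Monochromatic components and choosability\<close>

lemma pair_graph_relD:
  assumes "pair_graph G"
  shows "sym (parcs G)" "irrefl (parcs G)" "finite (pverts G)"
    "(v, w) \<in> parcs G \<Longrightarrow> v \<in> pverts G \<and> w \<in> pverts G"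
proof -
  interpret pair_graph G by fact
  show "sym (parcs G)" using pair_sym_arcs by (simp add: symmetric_def)
  show "irrefl (parcs G)" using pair_no_loops by (force simp: irrefl_def)
  show "finite (pverts G)" by (rule pair_finite_verts)
  show "(v, w) \<in> parcs G \<Longrightarrow> v \<in> pverts G \<and> w \<in> pverts G"
    using arc_fst_in_verts arc_snd_in_verts by force
qed

lemma out_degree_mono_subgraph:
  assumes "pair_graph G"
  shows "out_degree (with_proj (mono_subgraph G f)) v = card (mono_nbs (parcs G) (pverts G) f v)"
proof -
  have "out_arcs (with_proj (mono_subgraph G f)) v = Pair v ` mono_nbs (parcs G) (pverts G) f v"
    using pair_graph_relD(4)[OF assms]
    by (auto simp: out_arcs_def mono_subgraph_def colour_nbs_def)
  then show ?thesis by (simp add: out_degree_def card_image inj_on_def)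
qed

text \<open>Monochromatic walks cannot leave a set closed under monochromatic neighbours, so a
  component is bounded by exhibiting a small closed set that meets it.\<close>

lemma mono_component_subset:
  assumes "pair_graph G" "C \<in> mono_components G f"
  shows "C \<noteq> {}" "C \<subseteq> pverts G"
    "v \<in> C \<Longrightarrow> v \<in> Z \<Longrightarrow> (\<And>x. x \<in> Z \<Longrightarrow> mono_nbs (parcs G) (pverts G) f x \<subseteq> Z) \<Longrightarrow> C \<subseteq> Z"
proof -
  let ?H = "with_proj (mono_subgraph G f)"
  have "pair_wf_digraph (mono_subgraph G f)"
    using pair_graph_relD(4)[OF assms(1)] by unfold_locales (auto simp: mono_subgraph_def)
  then interpret H: pair_wf_digraph "mono_subgraph G f" .
  have C: "C \<noteq> {}" "\<And>u v. u \<in> C \<Longrightarrow> v \<in> C \<Longrightarrow> u \<rightarrow>\<^sup>*\<^bsub>?H\<^esub> v"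
    using assms(2) unfolding mono_components_def pre_digraph.sccs_verts_def by auto
  show "C \<noteq> {}" by (fact C)
  show "C \<subseteq> pverts G"
    using C(2) H.reachable_in_verts(1) by (fastforce simp: mono_subgraph_def)
  assume v: "v \<in> C" "v \<in> Z"
    and closed: "\<And>x. x \<in> Z \<Longrightarrow> mono_nbs (parcs G) (pverts G) f x \<subseteq> Z"
  show "C \<subseteq> Z"
  proof
    fix w assume "w \<in> C"
    then have "(v, w) \<in> (parcs (mono_subgraph G f))\<^sup>*"
      using reachable_rtranclI[OF C(2)[OF v(1)]] by simp
    then show "w \<in> Z"
    proof induction
      case (step x y)
      then have "y \<in> mono_nbs (parcs G) (pverts G) f x"
        using pair_graph_relD(4)[OF assms(1)] by (auto simp: mono_subgraph_def colour_nbs_def)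
      then show ?case using closed step.IH by blast
    qed (fact v(2))
  qed
qed

text \<open>The star of \<open>v\<close> and its monochromatic neighbours is closed under
  monochromatic neighbours, since each leaf has only \<open>v\<close>. The vertex \<open>u\<close>,
  centre or leaf, ties \<open>C\<close> to this star.\<close>

lemma card_mono_component_le_star:
  assumes "pair_graph G" "C \<in> mono_components G f"
    and "u \<in> C" "u \<in> insert v (mono_nbs (parcs G) (pverts G) f v)" "v \<in> pverts G"
    and star: "\<And>w. w \<in> mono_nbs (parcs G) (pverts G) f v \<Longrightarrow>
      card (mono_nbs (parcs G) (pverts G) f w) \<le> 1"
  shows "card C \<le> card (mono_nbs (parcs G) (pverts G) f v) + 1"
proof -
  let ?N = "mono_nbs (parcs G) (pverts G) f"
  note G = pair_graph_relD[OF assms(1)]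
  have "?N w \<subseteq> {v}" if w: "w \<in> ?N v" for w
  proof -
    have "v \<in> ?N w"
      using w symD[OF G(1), of v w] assms(5) by (auto simp: colour_nbs_def)
    moreover have "finite (?N w)" using G(3) by simp
    ultimately show ?thesis
      using star[OF w] card_le_Suc0_iff_eq[of "?N w"] by auto
  qed
  then have "C \<subseteq> insert v (?N v)"
    using assms(3,4) by (intro mono_component_subset(3)[OF assms(1,2), of u]) auto
  then have "card C \<le> card (insert v (?N v))"
    using G(3) by (intro card_mono) auto
  also have "\<dots> \<le> card (?N v) + 1"
    using G(3) by (simp add: card_insert_if)
  finally show ?thesis .
qed

lemma has_clustering_mono:
  "has_clustering G f c \<Longrightarrow> c \<le> c' \<Longrightarrow> has_clustering G f c'"
  by (fastforce simp: has_clustering_def)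

lemma choosable_with_clustering_mono:
  assumes "choosable_with_clustering TYPE('c) k G c" "k \<le> k'" "c \<le> c'"
  shows "choosable_with_clustering TYPE('c) k' G c'"
  using assms has_clustering_mono unfolding choosable_with_clustering_def list_assignment_def
  by (meson order_trans)

lemma has_defect_1_imp_has_clustering_2:
  assumes "pair_graph G" "has_defect G f 1"
  shows "has_clustering G f 2"
  unfolding has_clustering_def
proof
  fix C assume C: "C \<in> mono_components G f"
  then obtain v where v: "v \<in> C" "C \<subseteq> pverts G"
    using mono_component_subset(1,2)[OF assms(1) C] by auto
  have le_1: "card (mono_nbs (parcs G) (pverts G) f w) \<le> 1" if "w \<in> pverts G" for w
    using assms(2) that unfolding has_defect_def by (simp add: out_degree_mono_subgraph[OF assms(1)])
  have "w \<in> pverts G" if "w \<in> mono_nbs (parcs G) (pverts G) f v" for w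
    using that by (simp add: colour_nbs_def)
  then have "card C \<le> card (mono_nbs (parcs G) (pverts G) f v) + 1"
    using le_1 v by (intro card_mono_component_le_star[OF assms(1) C v(1)]) auto
  then show "card C \<le> 2" using le_1[of v] v by auto
qed

text \<open>The colouring lemmas ask for lists of size exactly \<open>k\<close>, whereas lists may
  be longer or infinite; a colouring from sublists is also one from the lists.\<close>

lemma list_assignment_finite_sublists:
  assumes "list_assignment k G L"
  shows "\<exists>L'. \<forall>v\<in>pverts G. finite (L' v) \<and> card (L' v) = k \<and> L' v \<subseteq> L v"
proof -
  have "\<exists>X. finite X \<and> card X = k \<and> X \<subseteq> L v" if "v \<in> pverts G" for v
  proof (cases "finite (L v)")
    case True
    then show ?thesis
      using assms that obtain_subset_with_card_n[of k "L v"] by (metis list_assignment_def)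
  next
    case False
    then show ?thesis using infinite_arbitrarily_large by blast
  qed
  then show ?thesis by metis
qed

lemma choosable_with_defect_1:
  assumes "pair_graph G"
    and "\<And>W. W \<subseteq> pverts G \<Longrightarrow> W \<noteq> {} \<Longrightarrow> 3 * degree_sum (parcs G) W < 4 * k * card W"
  shows "choosable_with_defect TYPE('c) k G 1"
  unfolding choosable_with_defect_def
proof (intro allI impI)
  fix L :: "'a \<Rightarrow> 'c set"
  assume "list_assignment k G L"
  then obtain L' where L': "\<forall>v\<in>pverts G. finite (L' v) \<and> card (L' v) = k \<and> L' v \<subseteq> L v"
    using list_assignment_finite_sublists by blast
  have "\<exists>f. (\<forall>v\<in>pverts G. f v \<in> L' v) \<and>
      (\<forall>v\<in>pverts G. card (mono_nbs (parcs G) (pverts G) f v) \<le> 1)"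
    by (rule sparse_colouring_defect_1[OF pair_graph_relD(1-3)[OF assms(1)] assms(2)]) (use L' in auto)
  then show "\<exists>f. list_colouring G L f \<and> has_defect G f 1"
    using L' unfolding list_colouring_def has_defect_def out_degree_mono_subgraph[OF assms(1)]
    by blast
qed

lemma choosable_with_clustering_3:
  assumes "pair_graph G"
    and "\<And>W. W \<subseteq> pverts G \<Longrightarrow> W \<noteq> {} \<Longrightarrow> 2 * degree_sum (parcs G) W < 3 * k * card W"
  shows "choosable_with_clustering TYPE('c) k G 3"
  unfolding choosable_with_clustering_def
proof (intro allI impI)
  fix L :: "'a \<Rightarrow> 'c set"
  assume "list_assignment k G L"
  then obtain L' where L': "\<forall>v\<in>pverts G. finite (L' v) \<and> card (L' v) = k \<and> L' v \<subseteq> L v"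
    using list_assignment_finite_sublists by blast
  let ?N = "mono_nbs (parcs G) (pverts G)"
  have "\<exists>f. (\<forall>v\<in>pverts G. f v \<in> L' v) \<and> (\<forall>v\<in>pverts G. card (?N f v) \<le> 2 \<and>
       (card (?N f v) = 2 \<longrightarrow> (\<forall>w\<in>?N f v. card (?N f w) \<le> 1)))"
    by (rule sparse_colouring_clustering_3[OF pair_graph_relD(1-3)[OF assms(1)] assms(2)]) (use L' in auto)
  then obtain f where f: "\<forall>v\<in>pverts G. f v \<in> L' v"
    "\<forall>v\<in>pverts G. card (?N f v) \<le> 2 \<and>
       (card (?N f v) = 2 \<longrightarrow> (\<forall>w\<in>?N f v. card (?N f w) \<le> 1))"
    by blast
  have "card C \<le> 3" if C: "C \<in> mono_components G f" for C
  proof -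
    obtain u where u: "u \<in> C" "u \<in> pverts G"
      using mono_component_subset(1,2)[OF assms(1) C] by auto
    \<comment> \<open>The centre of the star is a monochromatic neighbour of \<open>u\<close> of
      degree \<open>2\<close> if there is one, and \<open>u\<close> otherwise.\<close>
    have "\<exists>v\<in>pverts G. u \<in> insert v (?N f v) \<and> (\<forall>w\<in>?N f v. card (?N f w) \<le> 1)"
    proof (cases "\<exists>w\<in>?N f u. card (?N f w) = 2")
      case True
      then obtain w where w: "w \<in> ?N f u" "card (?N f w) = 2" by auto
      then have "w \<in> pverts G" by (simp add: colour_nbs_def)
      moreover have "u \<in> ?N f w"
        using w(1) u(2) symD[OF pair_graph_relD(1)[OF assms(1)], of u w] by (auto simp: colour_nbs_def)
      ultimately show ?thesis using f(2) w(2) by blast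
    next
      case False
      have "card (?N f w) \<le> 1" if w: "w \<in> ?N f u" for w
      proof -
        have "w \<in> pverts G" using w by (simp add: colour_nbs_def)
        then have "card (?N f w) \<le> 2" "card (?N f w) \<noteq> 2" using False f(2) w by auto
        then show ?thesis by simp
      qed
      then show ?thesis using u(2) by blast
    qed
    then obtain v where v: "v \<in> pverts G" "u \<in> insert v (?N f v)" "\<forall>w\<in>?N f v. card (?N f w) \<le> 1"
      by blast
    have "card C \<le> card (?N f v) + 1"
      using v by (intro card_mono_component_le_star[OF assms(1) C u(1)]) auto
    also have "card (?N f v) \<le> 2" using f(2) v(1) by blast
    finally show ?thesis by simp
  qed
  then have "has_clustering G f 3" by (simp add: has_clustering_def)
  then show "\<exists>f. list_colouring G L f \<and> has_clustering G f 3"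
    using f(1) L' unfolding list_colouring_def by blast
qed

theorem theorem27:
  fixes k :: nat and G :: "'a pair_pre_digraph"
  assumes "k \<ge> 1" and "stack_graph k G"
  shows "choosable_with_defect TYPE('c) ((3 * k + 4) div 2) G 1 \<and>
         choosable_with_clustering TYPE('c) ((3 * k + 4) div 2) G 2 \<and>
         choosable_with_clustering TYPE('c) ((7 * k + 11) div 5) G 9 \<and>
         choosable_with_clustering TYPE('c) ((4 * k + 6) div 3) G (76 * k + 53)"
proof -
  have G: "pair_graph G" using assms(2) by (simp add: stack_graph_def)
  have sparse: "degree_sum (parcs G) W < (2 * k + 2) * card W" if "W \<subseteq> pverts G" "W \<noteq> {}" for W
  proof -
    obtain vs S where "stack_layout k G vs S" using assms(2) by (auto simp: stack_graph_def)
    from stack_layout_sparse[OF G this that] show ?thesis by simp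
  qed
  have defect: "choosable_with_defect TYPE('c) ((3 * k + 4) div 2) G 1"
  proof (rule choosable_with_defect_1[OF G])
    fix W assume "W \<subseteq> pverts G" "W \<noteq> {}"
    then have "3 * degree_sum (parcs G) W < 3 * (2 * k + 2) * card W" using sparse[of W] by (simp add: algebra_simps)
    \<comment> \<open>Rounding down loses at most \<open>1\<close>, so
      \<open>2 * ((3 * k + 4) div 2)\<close> is at least \<open>3 * k + 3\<close>.\<close>
    also have "\<dots> \<le> 4 * ((3 * k + 4) div 2) * card W" by (intro mult_le_mono1) presburger
    finally show "3 * degree_sum (parcs G) W < 4 * ((3 * k + 4) div 2) * card W" .
  qed
  have clustering: "choosable_with_clustering TYPE('c) ((4 * k + 6) div 3) G 3"
  proof (rule choosable_with_clustering_3[OF G])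
    fix W assume "W \<subseteq> pverts G" "W \<noteq> {}"
    then have "2 * degree_sum (parcs G) W < 2 * (2 * k + 2) * card W" using sparse[of W] by (simp add: algebra_simps)
    \<comment> \<open>Rounding down loses at most \<open>2\<close>, so
      \<open>3 * ((4 * k + 6) div 3)\<close> is at least \<open>4 * k + 4\<close>.\<close>
    also have "\<dots> \<le> 3 * ((4 * k + 6) div 3) * card W" by (intro mult_le_mono1) presburger
    finally show "2 * degree_sum (parcs G) W < 3 * ((4 * k + 6) div 3) * card W" .
  qed
  have "choosable_with_clustering TYPE('c) ((3 * k + 4) div 2) G 2"
    using defect has_defect_1_imp_has_clustering_2[OF G]
    unfolding choosable_with_defect_def choosable_with_clustering_def by blast
  moreover have "choosable_with_clustering TYPE('c) ((7 * k + 11) div 5) G 9"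
  proof (rule choosable_with_clustering_mono[OF clustering])
    \<comment> \<open>The comparison rests on
      \<open>5 * (4 * k + 6) \<le> 3 * (7 * k + 11)\<close>.\<close>
    have "3 * ((4 * k + 6) div 3) \<le> 4 * k + 6" by simp
    then have "(4 * k + 6) div 3 * 5 \<le> 7 * k + 11" by linarith
    then show "(4 * k + 6) div 3 \<le> (7 * k + 11) div 5"
      by (simp add: less_eq_div_iff_mult_less_eq)
  qed simp
  moreover have "choosable_with_clustering TYPE('c) ((4 * k + 6) div 3) G (76 * k + 53)"
    using clustering by (rule choosable_with_clustering_mono) auto
  ultimately show ?thesis using defect by blast
qed

end
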